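(* Let $G$ be a nontrivial proper subgroup of $\mathbb{Q}$. There is an $\omega\times2$ matrix $A$ with rational entries that is weakly image partition regular over $G$, but there does not exist an $\omega\times2$ matrix $C$ with rational entries such that $$\{A\vec x:\vec x\in G^2\}\cap(G\setminus\{0\})^\omega=\{C\vec y:\vec y\in(G\setminus\{0\})^2\}\cap(G\setminus\{0\})^\omega.$$
   Context: $\omega=\{0,1,2,\dots\}$; an $\omega\times2$ matrix has rows indexed by $\omega$ and two columns. A finite colouring is a function with finite range; monochromatic means constant colour. $A$ is weakly image partition regular over the group $G$ if for every finite colouring of $G\setminus\{0\}$ there is $\vec x\in G^2$ with the entries of $A\vec x$ in $G\setminus\{0\}$ and monochromatic. *)

theory Defs
  imports "HOL-Analysis.Finite_Cartesian_Product" "HOL-Algebra.Group"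
begin

definition rat_group :: "rat monoid" where
  "rat_group = \<lparr>carrier = UNIV, monoid.mult = (+), one = (0::rat)\<rparr>"

text \<open>An \<open>\<omega> \<times> 2\<close> rational matrix is given by its sequence of rows.\<close>

type_synonym omega2_matrix = "nat \<Rightarrow> rat ^ 2"

definition mat_apply :: "omega2_matrix \<Rightarrow> rat ^ 2 \<Rightarrow> nat \<Rightarrow> rat" where
  "mat_apply A x = (\<lambda>i. \<Sum>j\<in>UNIV. A i $ j * x $ j)"

definition vecs2 :: "rat set \<Rightarrow> (rat ^ 2) set" where
  "vecs2 S = {x. \<forall>j. x $ j \<in> S}"

definition seqs :: "rat set \<Rightarrow> (nat \<Rightarrow> rat) set" where
  "seqs S = {v. \<forall>i. v i \<in> S}"

text \<open>Colours are natural numbers; as the range of a colouring is finite, this loses no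
  generality. Values of a colouring outside \<open>G - {0}\<close> are irrelevant.\<close>

definition weakly_image_partition_regular :: "omega2_matrix \<Rightarrow> rat set \<Rightarrow> bool" where
  "weakly_image_partition_regular A G \<longleftrightarrow>
     (\<forall>c :: rat \<Rightarrow> nat. finite (c ` (G - {0})) \<longrightarrow>
        (\<exists>x \<in> vecs2 G. mat_apply A x \<in> seqs (G - {0}) \<and>
           (\<exists>k. \<forall>i. c (mat_apply A x i) = k)))"

end

theory Submission
  imports Defs "HOL-Analysis.Cartesian_Space"
begin

text \<open>As \<open>G\<close> is not divisible, there are \<open>k > 0\<close> and \<open>h \<in> G - k G\<close>. Let row \<open>n\<close> of \<open>A\<close> be
  \<open>(k, k\<^sup>2 n)\<close>. The vectors \<open>(g, 0)\<close> have constant images, whence weak image partition regularity.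
  Suppose that \<open>C\<close> has the same nonzero images. Then \<open>C\<close> has rank two and its columns are affine
  in \<open>n\<close>. Each column has a zero entry, since otherwise a multiple of it would be an admissible
  image of \<open>A\<close>, whose unique preimage under \<open>C\<close> has a zero coordinate. So the columns are
  multiples of \<open>n - n\<^sub>1\<close> and \<open>n - n\<^sub>2\<close>. If \<open>C (a, b)\<close> is the constant sequence \<open>k h\<close>, then
  \<open>C ((n\<^sub>2 + 1) a, (n\<^sub>1 + 1) b)\<close> is the sequence \<open>k h (n + 1)\<close>, which is not an image of \<open>A\<close>
  because its increment \<open>k h\<close> is not in \<open>k\<^sup>2 G\<close>.\<close>

lemma rat_subgroupD:
  assumes "subgroup G rat_group"
  shows "0 \<in> G" "\<And>x y. x \<in> G \<Longrightarrow> y \<in> G \<Longrightarrow> x + y \<in> G"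
    "\<And>x m. x \<in> G \<Longrightarrow> of_int m * x \<in> G"
proof -
  interpret subgroup G rat_group by fact
  show zero: "0 \<in> G" using one_closed by (simp add: rat_group_def)
  show add: "x + y \<in> G" if "x \<in> G" "y \<in> G" for x y
    using m_closed[OF that] by (simp add: rat_group_def)
  have "group rat_group"
    by (rule groupI) (auto simp: rat_group_def add.assoc intro: exI[of _ "- x" for x])
  then interpret group rat_group .
  have neg: "- x \<in> G" if "x \<in> G" for x
  proof -
    have "inv\<^bsub>rat_group\<^esub> x = - x"
      by (rule inv_equality) (auto simp: rat_group_def)
    with m_inv_closed[OF that] show ?thesis by simp
  qed
  have nat: "of_nat n * x \<in> G" if "x \<in> G" for n x
    by (induction n) (auto simp: zero add that distrib_right)
  show "of_int m * x \<in> G" if "x \<in> G" for x m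
    using nat[OF that] neg[OF nat[OF that]] by (cases m rule: int_cases2) auto
qed

text \<open>For nonzero \<open>g\<close> in \<open>G\<close> and any \<open>q\<close> outside
  \<open>G\<close>, \<open>q\<close> is an integer multiple of \<open>g / k\<close>, with
  \<open>k\<close> the denominator of \<open>q / g\<close>; hence \<open>g / k\<close> cannot lie in
  \<open>G\<close>.\<close>

lemma rat_subgroup_not_divisible:
  assumes G: "subgroup G rat_group" and "G \<noteq> {0}" "G \<noteq> UNIV"
  obtains k :: int and h :: rat where "k > 0" "h \<in> G" "h / of_int k \<notin> G"
proof -
  obtain g where g: "g \<in> G" "g \<noteq> 0"
    using assms rat_subgroupD(1)[OF G] by blast
  obtain q where q: "q \<notin> G" using assms by blast
  obtain m k where mk: "q / g = of_int m / of_int k" "k > 0"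
    by (metis Fract_of_int_quotient Rat_cases)
  have "q = of_int m * (g / of_int k)" using g mk by (simp add: field_simps)
  with q have "g / of_int k \<notin> G" using rat_subgroupD(3)[OF G] by metis
  with that mk g show thesis by blast
qed

text \<open>Multiplying \<open>g\<close> by both denominators makes the products integer multiples
  of \<open>g\<close>.\<close>

lemma rat_mult_mem_subgroup:
  assumes G: "subgroup G rat_group" and g: "g \<in> G" "g \<noteq> 0"
  obtains t where "t \<in> G" "t \<noteq> 0" "t * p \<in> G" "t * q \<in> G"
proof -
  obtain p1 p2 where p: "p = of_int p1 / of_int p2" "p2 > 0"
    by (metis Fract_of_int_quotient Rat_cases)
  obtain q1 q2 where q: "q = of_int q1 / of_int q2" "q2 > 0"
    by (metis Fract_of_int_quotient Rat_cases)
  let ?t = "of_int (p2 * q2) * g"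
  have "?t * p = of_int (p1 * q2) * g" "?t * q = of_int (p2 * q1) * g"
    using p q by (simp_all add: field_simps)
  then have "?t * p \<in> G" "?t * q \<in> G" using rat_subgroupD(3)[OF G g(1)] by metis+
  moreover have "?t \<noteq> 0" using g p q by simp
  ultimately show thesis using that[OF rat_subgroupD(3)[OF G g(1)]] by blast
qed

text \<open>The sequences \<open>a\<close> and \<open>b\<close> are the columns of \<open>C\<close>, and \<open>k x\<^sub>1 + k\<^sup>2 n x\<^sub>2\<close> is
  entry \<open>n\<close> of the image of \<open>(x\<^sub>1, x\<^sub>2)\<close> under \<open>A\<close>.\<close>

lemma column_affine_with_zero:
  fixes a b :: "nat \<Rightarrow> rat" and k :: rat
  assumes G: "subgroup G rat_group" and g: "g \<in> G" "g \<noteq> 0" and k: "k = of_int m" "m > 0"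
    and repr: "\<And>x1 x2. x1 \<in> G \<Longrightarrow> x2 \<in> G \<Longrightarrow>
        (\<And>n. k * x1 + k\<^sup>2 * of_nat n * x2 \<in> G - {0}) \<Longrightarrow>
        \<exists>y1\<in>G - {0}. \<exists>y2\<in>G - {0}. \<forall>n. a n * y1 + b n * y2 = k * x1 + k\<^sup>2 * of_nat n * x2"
  obtains \<beta> N where "\<And>n. a n = \<beta> * (of_nat n - of_nat N)"
proof -
  have mem: "of_int i * x \<in> G" if "x \<in> G" for i x using rat_subgroupD(3)[OF G that] .
  have k0: "k > 0" using k by simp
  have kmem: "k * x \<in> G" if "x \<in> G" for x using mem[OF that] k by simp
  have const: "k * g + k\<^sup>2 * of_nat n * 0 \<in> G - {0}" for n
    using kmem g k0 by simp
  have lin: "k * g + k\<^sup>2 * of_nat n * g \<in> G - {0}" for n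
  proof -
    have "k * g + k\<^sup>2 * of_nat n * g = (k + k\<^sup>2 * of_nat n) * g" by (simp add: algebra_simps)
    moreover have "k + k\<^sup>2 * of_nat n = of_int (m + m\<^sup>2 * int n)" using k by simp
    moreover have "k + k\<^sup>2 * of_nat n > 0" using k0 by (simp add: add_pos_nonneg)
    ultimately show ?thesis using mem[OF g(1)] g(2)
      by (metis Diff_iff mult_eq_0_iff order_less_irrefl singletonD)
  qed
  obtain y1 y2 where y: "y1 \<noteq> 0" "\<And>n. a n * y1 + b n * y2 = k * g"
    using repr[OF g(1) rat_subgroupD(1)[OF G] const] by auto
  obtain z1 z2 where z: "\<And>n. a n * z1 + b n * z2 = k * g + k\<^sup>2 * of_nat n * g"
    using repr[OF g(1) g(1) lin] by blast
  \<comment> \<open>For each \<open>n\<close> the two images form a linear system in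
    \<open>a n\<close> and \<open>b n\<close> with determinant \<open>D\<close>, which is solved by
    Cramer's rule.\<close>
  define D where "D = y1 * z2 - y2 * z1"
  have aD: "a n * D = k * g * z2 - (k * g + k\<^sup>2 * of_nat n * g) * y2" for n
    using y(2)[of n] z[of n] unfolding D_def by algebra
  have bD: "b n * D = (k * g + k\<^sup>2 * of_nat n * g) * y1 - k * g * z1" for n
    using y(2)[of n] z[of n] unfolding D_def by algebra
  have D0: "D \<noteq> 0"
  proof
    assume "D = 0"
    then have "k\<^sup>2 * g * y1 = 0" using bD[of 0] bD[of 1] by (auto simp: algebra_simps)
    then show False using k0 g y by simp
  qed
  \<comment> \<open>Multiplied by \<open>D\<close>, the relation is affine in \<open>n\<close>, so
    both its coefficients vanish. This makes \<open>(u, v)\<close> parallel to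
    \<open>(y1, y2)\<close> and to \<open>(z1, z2)\<close>, which are independent.\<close>
  have inj: "v = 0" if uv: "\<And>n. a n * u + b n * v = 0" for u v
  proof -
    have "u * (a n * D) + v * (b n * D) = 0" for n
      using arg_cong[OF uv[of n], of "\<lambda>w. w * D"] by (simp add: algebra_simps)
    note e = this[unfolded aD bD]
    have "k\<^sup>2 * g * (v * y1 - u * y2) = 0"
      using e[of 0] e[of 1] unfolding of_nat_0 of_nat_1 by algebra
    then have 1: "v * y1 = u * y2" using k0 g by simp
    have "k * g * (u * z2 - v * z1) + k * g * (v * y1 - u * y2) = 0"
      using e[of 0] by (simp add: algebra_simps)
    then have 2: "u * z2 = v * z1" using 1 k0 g by simp
    have "v * D = (v * y1) * z2 - (v * z1) * y2" by (simp add: D_def algebra_simps)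
    also have "\<dots> = 0" unfolding 1 2[symmetric] by simp
    finally show "v = 0" using D0 by simp
  qed
  define \<alpha> where "\<alpha> = k * g * (z2 - y2) / D"
  define \<beta> where "\<beta> = - (k\<^sup>2 * g * y2) / D"
  have a: "a n = \<alpha> + \<beta> * of_nat n" for n
  proof -
    have "a n = (a n * D) / D" using D0 by simp
    then show ?thesis
      unfolding aD \<alpha>_def \<beta>_def by (simp add: algebra_simps diff_divide_distrib add_divide_distrib)
  qed
  have "\<exists>N. a N = 0"
  proof (rule ccontr)
    assume nz: "\<nexists>N. a N = 0"
    obtain t' where t': "t' \<in> G" "t' \<noteq> 0" "t' * \<alpha> \<in> G" "t' * \<beta> \<in> G"
      using rat_mult_mem_subgroup[OF G g] .
    \<comment> \<open>The factor \<open>k\<^sup>2\<close> makes \<open>t * a n\<close> an image of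
      \<open>A\<close>, namely of \<open>(k * t' * \<alpha>, t' * \<beta>)\<close>.\<close>
    define t where "t = k\<^sup>2 * t'"
    have t: "t \<noteq> 0" using t' k0 by (simp add: t_def)
    have x: "k * (t' * \<alpha>) \<in> G" "t' * \<beta> \<in> G" using kmem t' by auto
    have ta: "k * (k * (t' * \<alpha>)) + k\<^sup>2 * of_nat n * (t' * \<beta>) = t * a n" for n
      unfolding a t_def by (simp add: algebra_simps power2_eq_square)
    have "k * (k * (t' * \<alpha>)) + k\<^sup>2 * of_nat n * (t' * \<beta>) \<in> G - {0}" for n
    proof -
      have "k * (k * (t' * \<alpha> + of_int (int n) * (t' * \<beta>))) \<in> G"
        by (intro kmem rat_subgroupD(2)[OF G] mem t')
      then have "t * a n \<in> G"
        unfolding ta[symmetric] using k0 by (simp add: algebra_simps power2_eq_square)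
      then show ?thesis unfolding ta using nz t by auto
    qed
    from repr[OF x this] obtain w1 w2
      where w: "w2 \<noteq> 0" "\<And>n. a n * w1 + b n * w2 = t * a n"
      unfolding ta by blast
    \<comment> \<open>The vector \<open>(t, 0)\<close> has the same image under \<open>C\<close> as
      \<open>(w1, w2)\<close>.\<close>
    have "a n * (w1 - t) + b n * w2 = 0" for n
      using w(2)[of n] by (simp add: algebra_simps)
    from inj[OF this] w(1) show False by simp
  qed
  then obtain N where "a N = 0" by blast
  then have "\<alpha> = - \<beta> * of_nat N" using a[of N] by simp
  then have "a n = \<beta> * (of_nat n - of_nat N)" for n using a[of n] by (simp add: algebra_simps)
  then show thesis by (rule that)
qed

theorem theorem3p3:
  fixes G :: "rat set"
  assumes "subgroup G rat_group"
    and "G \<noteq> {0}"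
    and "G \<noteq> UNIV"
  shows "\<exists>A :: omega2_matrix. weakly_image_partition_regular A G \<and>
           \<not> (\<exists>C :: omega2_matrix.
                {mat_apply A x | x. x \<in> vecs2 G} \<inter> seqs (G - {0}) =
                {mat_apply C y | y. y \<in> vecs2 (G - {0})} \<inter> seqs (G - {0}))"
proof -
  note G = assms(1)
  have mem: "of_int i * x \<in> G" if "x \<in> G" for i x using rat_subgroupD(3)[OF G that] .
  obtain m h where m: "m > 0" and h: "h \<in> G" "h / of_int m \<notin> G"
    using rat_subgroup_not_divisible[OF assms] .
  define k :: rat where "k = of_int m"
  have k0: "k > 0" using m by (simp add: k_def)
  have h0: "h \<noteq> 0" using h rat_subgroupD(1)[OF G] by auto
  define A :: omega2_matrix where "A = (\<lambda>n. vector [k, k\<^sup>2 * of_nat n])"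
  have A: "mat_apply A x = (\<lambda>n. k * x $ 1 + k\<^sup>2 * of_nat n * x $ 2)" for x
    by (simp add: mat_apply_def A_def sum_2)
  have vec: "vector [x1, x2] \<in> vecs2 S \<longleftrightarrow> x1 \<in> S \<and> x2 \<in> S" for x1 x2 S
    by (simp add: vecs2_def forall_2)
  have "weakly_image_partition_regular A G"
    unfolding weakly_image_partition_regular_def
  proof (intro allI impI bexI conjI exI)
    show "vector [h, 0] \<in> vecs2 G" using vec h rat_subgroupD(1)[OF G] by simp
    show "mat_apply A (vector [h, 0]) \<in> seqs (G - {0})"
      using mem[OF h(1), of m] h0 k0 by (simp add: A seqs_def k_def)
    show "c (mat_apply A (vector [h, 0]) i) = c (k * h)" for c :: "rat \<Rightarrow> nat" and i
      by (simp add: A)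
  qed
  moreover have False
    if eq: "{mat_apply A x | x. x \<in> vecs2 G} \<inter> seqs (G - {0}) =
       {mat_apply C y | y. y \<in> vecs2 (G - {0})} \<inter> seqs (G - {0})" for C :: omega2_matrix
  proof -
    define a b where "a n = C n $ 1" and "b n = C n $ 2" for n
    have C: "mat_apply C y = (\<lambda>n. a n * y $ 1 + b n * y $ 2)" for y
      by (simp add: mat_apply_def a_def b_def sum_2)
    have repr: "\<exists>y1\<in>G - {0}. \<exists>y2\<in>G - {0}. \<forall>n. a n * y1 + b n * y2 = k * x1 + k\<^sup>2 * of_nat n * x2"
      if x: "x1 \<in> G" "x2 \<in> G" "\<And>n. k * x1 + k\<^sup>2 * of_nat n * x2 \<in> G - {0}" for x1 x2
    proof -
      have "mat_apply A (vector [x1, x2]) \<in> {mat_apply A x | x. x \<in> vecs2 G} \<inter> seqs (G - {0})"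
      proof
        show "mat_apply A (vector [x1, x2]) \<in> {mat_apply A x | x. x \<in> vecs2 G}"
          using x vec[of x1 x2 G] by blast
        show "mat_apply A (vector [x1, x2]) \<in> seqs (G - {0})"
          using x by (simp add: A seqs_def)
      qed
      then obtain y where "y \<in> vecs2 (G - {0})" "mat_apply C y = mat_apply A (vector [x1, x2])"
        unfolding eq by auto
      then show ?thesis unfolding A C vecs2_def forall_2 fun_eq_iff
        by (intro bexI[of _ "y $ 1"] bexI[of _ "y $ 2"]) auto
    qed
    obtain \<beta> N where a: "\<And>n. a n = \<beta> * (of_nat n - of_nat N)"
      using column_affine_with_zero[OF G h(1) h0 k_def m repr] by blast
    \<comment> \<open>Swapping the columns lets the same lemma treat \<open>b\<close>.\<close>
    have repr': "\<exists>y1\<in>G - {0}. \<exists>y2\<in>G - {0}. \<forall>n. b n * y1 + a n * y2 = k * x1 + k\<^sup>2 * of_nat n * x2"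
      if "x1 \<in> G" "x2 \<in> G" "\<And>n. k * x1 + k\<^sup>2 * of_nat n * x2 \<in> G - {0}" for x1 x2
      using repr[OF that] by (metis add.commute)
    obtain \<gamma> M where b: "\<And>n. b n = \<gamma> * (of_nat n - of_nat M)"
      using column_affine_with_zero[OF G h(1) h0 k_def m repr'] by blast
    have "k * h + k\<^sup>2 * of_nat n * 0 \<in> G - {0}" for n
      using mem[OF h(1), of m] h0 k0 by (simp add: k_def)
    from repr[OF h(1) rat_subgroupD(1)[OF G] this] obtain y1 y2
      where y: "y1 \<in> G - {0}" "y2 \<in> G - {0}" "\<And>n. a n * y1 + b n * y2 = k * h" by auto
    \<comment> \<open>These multipliers place the zero of the image at \<open>n = -1\<close>,
      outside the index set; adding 1 also keeps both coordinates nonzero when \<open>M\<close> or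
      \<open>N\<close> is 0.\<close>
    define y where "y = (vector [of_int (int M + 1) * y1, of_int (int N + 1) * y2] :: rat^2)"
    have "y \<in> vecs2 (G - {0})"
      unfolding y_def vec using mem y of_int_eq_0_iff[where 'a = rat]
      by (auto simp del: of_int_add of_int_of_nat_eq)
    moreover have Cy: "mat_apply C y = (\<lambda>n. k * h * of_nat (Suc n))"
    proof
      fix n
      \<comment> \<open>This is the slope of the constant sequence \<open>k * h\<close>.\<close>
      have s: "\<beta> * y1 + \<gamma> * y2 = 0" using y(3)[of 0] y(3)[of 1] by (simp add: a b algebra_simps)
      have g: "\<gamma> * y2 = - (\<beta> * y1)" using s by simp
      have e: "k * h = \<beta> * y1 * (of_nat M - of_nat N)"
      proof -
        have "k * h = (\<gamma> * y2) * - of_nat M - \<beta> * y1 * of_nat N"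
          using y(3)[of 0] by (simp add: a b algebra_simps)
        then show ?thesis unfolding g by (simp add: algebra_simps)
      qed
      have "mat_apply C y n = (\<beta> * y1) * (of_nat n - of_nat N) * (of_nat M + 1)
          + (\<gamma> * y2) * (of_nat n - of_nat M) * (of_nat N + 1)"
        by (simp add: C y_def a b algebra_simps)
      also have "\<dots> = k * h * of_nat (Suc n)" unfolding g e by (simp add: algebra_simps)
      finally show "mat_apply C y n = k * h * of_nat (Suc n)" .
    qed
    moreover have "mat_apply C y \<in> seqs (G - {0})"
    proof -
      have "k * h * of_nat (Suc n) = of_int (m * int (Suc n)) * h" for n by (simp add: k_def)
      then have "k * h * of_nat (Suc n) \<in> G" for n using mem[OF h(1)] by metis
      then show ?thesis unfolding Cy seqs_def using k0 h0 by (auto simp del: of_nat_Suc)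
    qed
    ultimately have "mat_apply C y \<in> {mat_apply A x | x. x \<in> vecs2 G} \<inter> seqs (G - {0})"
      unfolding eq by blast
    then obtain x where x: "x \<in> vecs2 G" "mat_apply C y = mat_apply A x" by blast
    have e: "k * h * of_nat (Suc n) = k * x $ 1 + k\<^sup>2 * of_nat n * x $ 2" for n
      using x(2) unfolding Cy A fun_eq_iff by blast
    have "k * h = k\<^sup>2 * x $ 2" using e[of 0] e[of 1] by (auto simp: algebra_simps)
    then have "h / k = x $ 2" using k0 by (simp add: field_simps power2_eq_square)
    moreover have "x $ 2 \<in> G" using x(1) by (simp add: vecs2_def)
    ultimately show False using h(2) by (simp add: k_def)
  qed
  ultimately show ?thesis by blast
qed

end
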